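(* Let $M>1$, $\mathcal R=[1/M,M]$, and $\epsilon\in(0,1]$. Let $P_q$ be any polyhedral approximation with $q$ additional variables and linear constraints such that $$K_{\exp}(-\epsilon)\subseteq P_q\subseteq K_{\exp}(\epsilon).$$ Then $q=\Omega\big(\log\log(M)+\log(1/\epsilon)\big)$.
   Context: For $\alpha\in\mathbb R$, $K_{\exp}(\alpha)=\{\boldsymbol x=(x_1,x_2,x_3)\in\mathcal R^2\times\mathbb R:\ \log(x_1/x_2)\ge x_3/x_2-\alpha\}$. A polyhedral approximation with $q$ additional variables and linear constraints is a set described by linear inequalities in $(x_1,x_2,x_3)$ and possibly additional real variables, the number of additional variables and linear constraints being $q$; the inclusions are understood for its projection onto $(x_1,x_2,x_3)$. $\Omega(\cdot)$ is the usual asymptotic notation, describing growth in $M$ and $1/\epsilon$. *)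

theory Defs
  imports "HOL-Analysis.Analysis"
begin

definition K_exp :: "real \<Rightarrow> real \<Rightarrow> (real^3) set" where
  "K_exp M \<alpha> = {x. x$1 \<in> {1/M..M} \<and> x$2 \<in> {1/M..M} \<and> ln (x$1 / x$2) \<ge> x$3 / x$2 - \<alpha>}"

text \<open>
  \<open>P\<close> is the projection onto \<open>x\<close> of a set cut out by \<open>m\<close> linear inequalities in \<open>x\<close> and \<open>n\<close>
  additional real variables \<open>y 0, ..., y (n - 1)\<close>; \<open>q\<close> counts these variables and inequalities
  together. All inequalities are counted, including any that only bound \<open>x$1\<close> and \<open>x$2\<close>.
\<close>
definition polyhedral_approximation :: "nat \<Rightarrow> (real^3) set \<Rightarrow> bool" where
  "polyhedral_approximation q P \<longleftrightarrow>
     (\<exists>n m (a :: nat \<Rightarrow> real^3) (B :: nat \<Rightarrow> nat \<Rightarrow> real) (b :: nat \<Rightarrow> real).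
        n + m = q \<and>
        P = {x. \<exists>y :: nat \<Rightarrow> real. \<forall>i<m. a i \<bullet> x + (\<Sum>j<n. B i j * y j) \<le> b i})"

end

theory Submission
  imports Defs
begin

text \<open>
  On the line \<open>x$1 = t\<close>, \<open>x$2 = 1\<close> the largest \<open>x$3\<close> in \<open>P\<close> exists and lies within \<open>\<epsilon>\<close> of
  \<open>ln t\<close>. If the lifts of two such topmost points satisfy the same inequalities with equality,
  then no point of \<open>P\<close> lies above their midpoint, so \<open>ln\<close> differs from its chord by at most
  \<open>2 * \<epsilon>\<close> there. Spacing the points geometrically with ratio \<open>exp (17 * sqrt \<epsilon>)\<close> violates
  this, so about \<open>ln M / sqrt \<epsilon>\<close> points have distinct sets of tight inequalities, of which
  there are at most \<open>2 ^ q\<close>.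
\<close>

section \<open>Closedness of projections of polyhedra\<close>

text \<open>Provides the value of an eliminated variable: \<open>L\<close> collects its lower bounds
  and \<open>U\<close> its upper bounds. Either set may be empty, so \<open>Max L\<close> alone is
  not always available as a witness.\<close>

lemma exists_between_finite_sets:
  fixes L U :: "real set"
  assumes "finite L" "finite U" "\<And>l u. l \<in> L \<Longrightarrow> u \<in> U \<Longrightarrow> l \<le> u"
  shows "\<exists>w. (\<forall>l\<in>L. l \<le> w) \<and> (\<forall>u\<in>U. w \<le> u)"
proof (cases "L = {}")
  case True
  then show ?thesis
    using assms(2) by (cases "U = {}") (auto intro: exI[of _ "Min U"])
next
  case False
  then have "Max L \<in> L" using assms(1) by simp
  then show ?thesis using assms by (intro exI[of _ "Max L"]) auto
qed

text \<open>Fourier--Motzkin elimination of one additional variable at a time.\<close>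

lemma closed_projection_linear_inequalities:
  fixes C :: "('a::euclidean_space \<times> (nat \<Rightarrow> real) \<times> real) set"
  assumes "finite C"
  shows "closed {x. \<exists>y. \<forall>(a, B, b)\<in>C. a \<bullet> x + (\<Sum>j<n. B j * y j) \<le> b}"
  using assms
proof (induction n arbitrary: C)
  case 0
  have "{x. \<exists>y::nat \<Rightarrow> real. \<forall>(a, B, b)\<in>C. a \<bullet> x + (\<Sum>j<0. B j * y j) \<le> b}
      = (\<Inter>(a, B, b)\<in>C. {x. a \<bullet> x \<le> b})"
    by auto
  then show ?case by (auto intro!: closed_INT closed_halfspace_le)
next
  case (Suc n)
  \<comment> \<open>Applied below to pairs with \<open>B n > 0\<close> and \<open>B' n < 0\<close>:
    the weights \<open>- B' n\<close> and \<open>B n\<close> are then positive, and the coefficients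
    of \<open>y n\<close> cancel.\<close>
  define combine where
    "combine = (\<lambda>(a :: 'a, B, b :: real) (a' :: 'a, B', b' :: real).
       (((- B' n) *\<^sub>R a + B n *\<^sub>R a'), (\<lambda>j. - B' n * B j + B n * B' j), - B' n * b + B n * b'))"
  define C0 where "C0 = {(a, B, b) \<in> C. B n = 0}"
  define Cp where "Cp = {(a, B, b) \<in> C. B n > 0}"
  define Cn where "Cn = {(a, B, b) \<in> C. B n < 0}"
  define C' where "C' = C0 \<union> (\<lambda>(p, q). combine p q) ` (Cp \<times> Cn)"
  have fin: "finite C0" "finite Cp" "finite Cn"
    using Suc.prems by (auto simp: C0_def Cp_def Cn_def intro: finite_subset)
  then have "finite C'" by (simp add: C'_def)
  have eval_combine: "((- B' n) *\<^sub>R a + B n *\<^sub>R a') \<bullet> x + (\<Sum>j<n. (- B' n * B j + B n * B' j) * y j)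
      = - B' n * (a \<bullet> x + (\<Sum>j<n. B j * y j)) + B n * (a' \<bullet> x + (\<Sum>j<n. B' j * y j))"
    for a a' x :: 'a and B B' y :: "nat \<Rightarrow> real"
    by (simp add: algebra_simps inner_add_left sum.distrib sum_distrib_left sum_negf sum_subtractf)
  have "(\<exists>y. \<forall>(a, B, b)\<in>C. a \<bullet> x + (\<Sum>j<Suc n. B j * y j) \<le> b) \<longleftrightarrow>
        (\<exists>y. \<forall>(a, B, b)\<in>C'. a \<bullet> x + (\<Sum>j<n. B j * y j) \<le> b)" for x
  proof
    assume "\<exists>y. \<forall>(a, B, b)\<in>C. a \<bullet> x + (\<Sum>j<Suc n. B j * y j) \<le> b"
    then obtain y where
      y: "\<And>a B b. (a, B, b) \<in> C \<Longrightarrow> a \<bullet> x + (\<Sum>j<n. B j * y j) + B n * y n \<le> b"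
      by (fastforce simp: add.assoc)
    have "a \<bullet> x + (\<Sum>j<n. B j * y j) \<le> b" if "(a, B, b) \<in> C0" for a B b
      using that y[of a B b] by (simp add: C0_def)
    moreover have "((- B' n) *\<^sub>R a + B n *\<^sub>R a') \<bullet> x + (\<Sum>j<n. (- B' n * B j + B n * B' j) * y j)
        \<le> - B' n * b + B n * b'"
      if "(a, B, b) \<in> Cp" "(a', B', b') \<in> Cn" for a B b a' B' b'
    proof -
      have "- B' n * (a \<bullet> x + (\<Sum>j<n. B j * y j) + B n * y n) \<le> - B' n * b"
        using that y[of a B b] by (intro mult_left_mono) (auto simp: Cp_def Cn_def)
      moreover have "B n * (a' \<bullet> x + (\<Sum>j<n. B' j * y j) + B' n * y n) \<le> B n * b'"
        using that y[of a' B' b'] by (intro mult_left_mono) (auto simp: Cp_def Cn_def)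
      ultimately show ?thesis
        unfolding eval_combine by (simp add: algebra_simps)
    qed
    ultimately show "\<exists>y. \<forall>(a, B, b)\<in>C'. a \<bullet> x + (\<Sum>j<n. B j * y j) \<le> b"
      unfolding C'_def combine_def by (intro exI[of _ y]) auto
  next
    assume "\<exists>y. \<forall>(a, B, b)\<in>C'. a \<bullet> x + (\<Sum>j<n. B j * y j) \<le> b"
    then obtain y where y: "\<And>a B b. (a, B, b) \<in> C' \<Longrightarrow> a \<bullet> x + (\<Sum>j<n. B j * y j) \<le> b"
      by fast
    \<comment> \<open>The inequality solved for \<open>y n\<close>: an upper bound if
      \<open>B n > 0\<close>, a lower bound if \<open>B n < 0\<close>.\<close>
    define bound where "bound = (\<lambda>(a, B, b). (b - a \<bullet> x - (\<Sum>j<n. B j * y j)) / B n)"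
    have "\<exists>w. (\<forall>l\<in>bound ` Cn. l \<le> w) \<and> (\<forall>u\<in>bound ` Cp. w \<le> u)"
    proof (rule exists_between_finite_sets)
      fix l u assume "l \<in> bound ` Cn" "u \<in> bound ` Cp"
      then obtain a B b a' B' b' where mem: "(a, B, b) \<in> Cp" "(a', B', b') \<in> Cn"
        and l: "l = bound (a', B', b')" and u: "u = bound (a, B, b)"
        by auto
      \<comment> \<open>Divided by the positive number \<open>- B' n * B n\<close>, the combined
        inequality says that this lower bound is at most this upper bound.\<close>
      have "combine (a, B, b) (a', B', b') \<in> C'"
        using mem unfolding C'_def by (auto simp: image_iff)
      then have "- B' n * (a \<bullet> x + (\<Sum>j<n. B j * y j)) + B n * (a' \<bullet> x + (\<Sum>j<n. B' j * y j))
          \<le> - B' n * b + B n * b'"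
        using y unfolding combine_def prod.case eval_combine[symmetric] by blast
      moreover have "B n > 0" "B' n < 0" using mem by (auto simp: Cp_def Cn_def)
      ultimately show "l \<le> u"
        unfolding l u bound_def by (simp add: field_simps)
    qed (use fin in auto)
    then obtain w where w: "\<And>c. c \<in> Cn \<Longrightarrow> bound c \<le> w" "\<And>c. c \<in> Cp \<Longrightarrow> w \<le> bound c"
      by auto
    have "a \<bullet> x + (\<Sum>j<Suc n. B j * (y(n := w)) j) \<le> b" if "(a, B, b) \<in> C" for a B b
    proof -
      have eq: "(\<Sum>j<Suc n. B j * (y(n := w)) j) = (\<Sum>j<n. B j * y j) + B n * w"
        by simp
      consider "B n = 0" | "B n > 0" | "B n < 0" by linarith
      then show ?thesis
      proof cases
        case 1
        then show ?thesis using y[of a B b] that unfolding eq by (auto simp: C'_def C0_def)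
      next
        case 2
        then show ?thesis using w(2)[of "(a, B, b)"] that unfolding eq
          by (auto simp: Cp_def bound_def field_simps)
      next
        case 3
        then show ?thesis using w(1)[of "(a, B, b)"] that unfolding eq
          by (auto simp: Cn_def bound_def field_simps)
      qed
    qed
    then show "\<exists>y. \<forall>(a, B, b)\<in>C. a \<bullet> x + (\<Sum>j<Suc n. B j * y j) \<le> b"
      by blast
  qed
  then show ?case using Suc.IH[OF \<open>finite C'\<close>] by simp
qed

text \<open>Ensures that the supremum of the heights of \<open>P\<close> on a vertical line is
  attained.\<close>

lemma closed_polyhedral_approximation:
  assumes "polyhedral_approximation q P"
  shows "closed P"
proof -
  obtain n m :: nat and a B b where
    P: "P = {x. \<exists>y :: nat \<Rightarrow> real. \<forall>i<m. a i \<bullet> x + (\<Sum>j<n. B i j * y j) \<le> b i}"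
    using assms unfolding polyhedral_approximation_def by blast
  have "P = {x. \<exists>y. \<forall>(a, B, b)\<in>(\<lambda>i. (a i, B i, b i)) ` {..<m}. a \<bullet> x + (\<Sum>j<n. B j * y j) \<le> b}"
    unfolding P by auto
  then show ?thesis
    using closed_projection_linear_inequalities[of "(\<lambda>i. (a i, B i, b i)) ` {..<m}" n] by simp
qed

section \<open>Counting points by their tight inequalities\<close>

text \<open>Distinct points have distinct sets of tight inequalities. Otherwise the step from the
  midpoint of the two lifts to a lift of the higher point given by \<open>mid\<close> does not
  increase any common tight inequality, so a short step in the same direction can be taken from the
  lift of \<open>x s\<close>, contradicting \<open>top\<close>.\<close>

lemma card_topmost_points_le:
  fixes x :: "'i \<Rightarrow> real^3" and e :: "real^3"
  assumes "polyhedral_approximation q P" and "finite T"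
    and mem: "\<And>t. t \<in> T \<Longrightarrow> x t \<in> P"
    and top: "\<And>t \<delta>. t \<in> T \<Longrightarrow> \<delta> > 0 \<Longrightarrow> x t + \<delta> *\<^sub>R e \<notin> P"
    and mid: "\<And>s t. s \<in> T \<Longrightarrow> t \<in> T \<Longrightarrow> s \<noteq> t \<Longrightarrow>
                \<exists>\<tau>>0. (1/2) *\<^sub>R (x s + x t) + \<tau> *\<^sub>R e \<in> P"
  shows "card T \<le> 2 ^ q"
proof -
  obtain n m a B b where nm: "n + m = q" and
    P: "P = {x. \<exists>y :: nat \<Rightarrow> real. \<forall>i<m. a i \<bullet> x + (\<Sum>j<n. B i j * y j) \<le> b i}"
    using assms(1) unfolding polyhedral_approximation_def by blast
  define F where "F i x y = a i \<bullet> x + (\<Sum>j<n. B i j * y j)" for i x and y :: "nat \<Rightarrow> real"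
  have P': "z \<in> P \<longleftrightarrow> (\<exists>y. \<forall>i<m. F i z y \<le> b i)" for z
    unfolding P F_def by simp
  obtain y where y: "\<And>t i. t \<in> T \<Longrightarrow> i < m \<Longrightarrow> F i (x t) (y t) \<le> b i"
    using mem unfolding P' by metis
  define tight where "tight t = {i. i < m \<and> F i (x t) (y t) = b i}" for t
  have "inj_on tight T"
  proof (rule inj_onI, rule ccontr)
    fix s t assume s: "s \<in> T" and t: "t \<in> T" and eq: "tight s = tight t" and "s \<noteq> t"
    then obtain \<tau> w where "\<tau> > 0" and
      w: "\<And>i. i < m \<Longrightarrow> F i ((1/2) *\<^sub>R (x s + x t) + \<tau> *\<^sub>R e) w \<le> b i"
      using mid[OF s t] unfolding P' by metis
    \<comment> \<open>The step in the additional variables; the accompanying step in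
      \<open>x\<close> is \<open>\<tau> *\<^sub>R e\<close>.\<close>
    define d where "d j = w j - (y s j + y t j) / 2" for j
    have mid_eq: "F i ((1/2) *\<^sub>R (x s + x t) + \<tau> *\<^sub>R e) w
        = (F i (x s) (y s) + F i (x t) (y t)) / 2 + F i (\<tau> *\<^sub>R e) d" for i
      unfolding F_def d_def
      by (simp add: algebra_simps inner_add_right sum.distrib sum_subtractf sum_divide_distrib add_divide_distrib)
    have move_eq: "F i (x s + \<delta> *\<^sub>R (\<tau> *\<^sub>R e)) (\<lambda>j. y s j + \<delta> * d j)
        = F i (x s) (y s) + \<delta> * F i (\<tau> *\<^sub>R e) d" for i \<delta>
      unfolding F_def
      by (simp add: algebra_simps inner_add_right sum.distrib sum_distrib_left)
    have "\<forall>\<^sub>F \<delta> in at_right 0. F i (x s) (y s) + \<delta> * F i (\<tau> *\<^sub>R e) d \<le> b i" if "i < m" for i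
    \<comment> \<open>A tight inequality holds with equality at the midpoint too, so it cannot grow
      along the step and every positive \<delta> works. An inequality with slack survives all
      sufficiently small \<delta>.\<close>
    proof (cases "i \<in> tight s")
      case True
      then have "F i (x s) (y s) = b i" "F i (x t) (y t) = b i"
        using eq by (auto simp: tight_def)
      with w[OF that] have "F i (\<tau> *\<^sub>R e) d \<le> 0" unfolding mid_eq by simp
      then have "\<delta> * F i (\<tau> *\<^sub>R e) d \<le> 0" if "\<delta> > 0" for \<delta>
        using that by (simp add: mult_nonneg_nonpos)
      then show ?thesis
        using \<open>F i (x s) (y s) = b i\<close> by (auto intro!: eventually_at_right_less[THEN eventually_mono])
    next
      case False
      then have "F i (x s) (y s) + 0 * F i (\<tau> *\<^sub>R e) d < b i"
        using y[OF s that] that by (auto simp: tight_def)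
      moreover have "((\<lambda>\<delta>. F i (x s) (y s) + \<delta> * F i (\<tau> *\<^sub>R e) d)
          \<longlongrightarrow> F i (x s) (y s) + 0 * F i (\<tau> *\<^sub>R e) d) (at_right 0)"
        by (intro tendsto_intros)
      ultimately show ?thesis
        by (auto dest!: order_tendstoD(2) elim: eventually_mono)
    qed
    then have "\<forall>\<^sub>F \<delta> in at_right 0. \<forall>i\<in>{..<m}. F i (x s) (y s) + \<delta> * F i (\<tau> *\<^sub>R e) d \<le> b i"
      by (intro eventually_ball_finite) auto
    then have "\<forall>\<^sub>F \<delta> in at_right (0::real). \<delta> > 0 \<and>
        (\<forall>i\<in>{..<m}. F i (x s) (y s) + \<delta> * F i (\<tau> *\<^sub>R e) d \<le> b i)"
      by (intro eventually_conj eventually_at_right_less)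
    then obtain \<delta> :: real where "\<delta> > 0"
      "\<And>i. i < m \<Longrightarrow> F i (x s) (y s) + \<delta> * F i (\<tau> *\<^sub>R e) d \<le> b i"
      by (auto dest!: eventually_happens)
    then have "x s + \<delta> *\<^sub>R (\<tau> *\<^sub>R e) \<in> P"
      unfolding P' move_eq[symmetric] by blast
    then show False
      using top[OF s, of "\<delta> * \<tau>"] \<open>\<delta> > 0\<close> \<open>\<tau> > 0\<close> by simp
  qed
  then have "card T \<le> card (Pow {..<m})"
    by (rule card_inj_on_le) (auto simp: tight_def)
  also have "\<dots> = 2 ^ m" by (simp add: card_Pow)
  also have "\<dots> \<le> 2 ^ q" using nm by simp
  finally show ?thesis .
qed

section \<open>Distance of the logarithm from its chords\<close>

text \<open>With \<open>b - a = 4 * v\<close>, the arithmetic mean of \<open>exp a\<close> and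
  \<open>exp b\<close> is their geometric mean times cosh (2v), and cosh (2v) = 1 + 2 sinh^2 v is at
  least \<open>1 + v\<^sup>2 / 2\<close>.\<close>

lemma exp_midpoint_gap:
  fixes a b \<epsilon> :: real
  assumes "0 < \<epsilon>" "\<epsilon> \<le> 1" "17 * sqrt \<epsilon> \<le> b - a"
  shows "(a + b) / 2 + 2 * \<epsilon> < ln ((exp a + exp b) / 2)"
proof -
  define v where "v = (b - a) / 4"
  have v: "v > 0" "17 * sqrt \<epsilon> \<le> 4 * v"
    using assms less_le_trans[of 0 "17 * sqrt \<epsilon>" "b - a"] by (auto simp: v_def)
  \<comment> \<open>The chain below needs \<open>v\<^sup>2 / 2 > 8 * \<epsilon>\<close>, that is, a
    square above 256 here; 17 is the first integer that achieves this.\<close>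
  have "289 * \<epsilon> \<le> 16 * v\<^sup>2"
    using power_mono[OF v(2), of 2] assms(1) by (simp add: power_mult_distrib)
  have "exp \<epsilon> \<le> 1 + 2 * \<epsilon>"
  proof -
    have "exp \<epsilon> \<le> 1 + \<epsilon> + \<epsilon>\<^sup>2" using assms by (intro exp_bound) auto
    also have "\<epsilon>\<^sup>2 \<le> \<epsilon>" using assms by (simp add: power2_eq_square mult_left_le)
    finally show ?thesis by simp
  qed
  then have "exp (2 * \<epsilon>) \<le> (1 + 2 * \<epsilon>)\<^sup>2"
    by (simp add: exp_double power_mono)
  also have "\<dots> = 1 + 4 * \<epsilon> + 4 * (\<epsilon> * \<epsilon>)" by (simp add: power2_eq_square algebra_simps)
  also have "\<dots> \<le> 1 + 8 * \<epsilon>" using assms by (simp add: mult_left_le)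
  also have "\<dots> < 1 + v\<^sup>2 / 2" using \<open>289 * \<epsilon> \<le> 16 * v\<^sup>2\<close> assms(1) by simp
  also have "\<dots> \<le> 1 + (exp v - exp (- v))\<^sup>2 / 2"
  proof -
    have "exp v \<ge> 1 + v" "exp (- v) \<le> 1" using v by (auto simp: exp_ge_add_one_self)
    then have "v \<le> exp v - exp (- v)" by linarith
    then show ?thesis using v power_mono[of v "exp v - exp (- v)" 2] by simp
  qed
  also have "\<dots> = (exp (- (2 * v)) + exp (2 * v)) / 2"
  proof -
    have inv: "exp v * exp (- v) = 1" by (simp flip: exp_add)
    have double: "exp (2 * v) = exp v * exp v" "exp (- (2 * v)) = exp (- v) * exp (- v)"
      by (simp_all flip: exp_add)
    have square: "(exp v - exp (- v))\<^sup>2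
        = exp v * exp v + exp (- v) * exp (- v) - 2 * (exp v * exp (- v))"
      by (simp only: power2_eq_square algebra_simps)
    show ?thesis
      unfolding square inv double by (simp add: add_divide_distrib diff_divide_distrib)
  qed
  finally have *: "exp (2 * \<epsilon>) < (exp (- (2 * v)) + exp (2 * v)) / 2" .
  have "exp ((a + b) / 2 + 2 * \<epsilon>) = exp ((a + b) / 2) * exp (2 * \<epsilon>)"
    by (simp add: exp_add)
  also have "\<dots> < exp ((a + b) / 2) * ((exp (- (2 * v)) + exp (2 * v)) / 2)"
    using * by simp
  also have "\<dots> = (exp ((a + b) / 2 - 2 * v) + exp ((a + b) / 2 + 2 * v)) / 2"
    unfolding exp_add exp_diff exp_minus by (simp only: divide_inverse algebra_simps)
  also have "\<dots> = (exp a + exp b) / 2"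
    by (simp add: v_def field_simps)
  finally have "exp ((a + b) / 2 + 2 * \<epsilon>) < (exp a + exp b) / 2" .
  moreover have "exp a + exp b > 0" by (simp add: add_pos_pos)
  ultimately show ?thesis
    using ln_less_cancel_iff[of "exp ((a + b) / 2 + 2 * \<epsilon>)" "(exp a + exp b) / 2"]
    by (simp del: ln_less_cancel_iff)
qed

section \<open>Lower bounds on the size of the approximation\<close>

lemma ln_le_two_power_polyhedral_approximation:
  fixes M \<epsilon> :: real
  assumes poly: "polyhedral_approximation q P"
    and inner: "K_exp M (- \<epsilon>) \<subseteq> P" and outer: "P \<subseteq> K_exp M \<epsilon>"
    and M: "M > 1" and \<epsilon>: "0 < \<epsilon>" "\<epsilon> \<le> 1"
  shows "ln M \<le> 17 * sqrt \<epsilon> * 2 ^ q"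
proof -
  \<comment> \<open>On the slice \<open>x$2 = 1\<close> the logarithmic condition of
    \<open>K_exp M \<alpha>\<close> becomes \<open>s \<le> ln t + \<alpha>\<close>.\<close>
  define pt :: "real \<Rightarrow> real \<Rightarrow> real^3" where "pt t s = vector [t, 1, s]" for t s
  define e :: "real^3" where "e = axis 3 1"
  have pt_add: "pt t s + \<delta> *\<^sub>R e = pt t (s + \<delta>)" for t s \<delta>
    by (simp add: pt_def e_def vec_eq_iff forall_3 axis_def)
  have pt_mid: "(1/2) *\<^sub>R (pt t s + pt t' s') = pt ((t + t') / 2) ((s + s') / 2)" for t s t' s'
    by (simp add: pt_def vec_eq_iff forall_3)
  have low: "pt t (ln t - \<epsilon>) \<in> P" if "1 \<le> t" "t \<le> M" for t
  proof -
    have "1 / M \<le> 1" using M by simp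
    then have "1 / M \<le> t" using that by linarith
    then have "pt t (ln t - \<epsilon>) \<in> K_exp M (- \<epsilon>)"
      using that M unfolding K_exp_def pt_def by simp
    then show ?thesis using inner by blast
  qed
  have high: "s \<le> ln t + \<epsilon>" if "pt t s \<in> P" for t s
    using that outer by (auto simp: K_exp_def pt_def)
  \<comment> \<open>The supremum is a maximum: the heights are bounded by \<open>high\<close>,
    nonempty by \<open>low\<close>, and form a closed set.\<close>
  define h where "h t = Sup {s. pt t s \<in> P}" for t
  have h_mem: "pt t (h t) \<in> P" and h_ge: "\<And>s. pt t s \<in> P \<Longrightarrow> s \<le> h t"
    if "1 \<le> t" "t \<le> M" for t
  proof -
    have bdd: "bdd_above {s. pt t s \<in> P}" using high by (intro bdd_aboveI[of _ "ln t + \<epsilon>"]) simp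
    have "closed ((\<lambda>s. pt t 0 + s *\<^sub>R e) -` P)"
      by (intro closed_vimage closed_polyhedral_approximation[OF poly] continuous_intros)
    then have "closed {s. pt t s \<in> P}" by (simp add: pt_add vimage_def)
    moreover have "{s. pt t s \<in> P} \<noteq> {}" using low[OF that] by blast
    ultimately have "h t \<in> {s. pt t s \<in> P}"
      unfolding h_def using bdd by (intro closed_contains_Sup)
    then show "pt t (h t) \<in> P" by simp
    show "s \<le> h t" if "pt t s \<in> P" for s
      using that bdd unfolding h_def by (auto intro: cSup_upper)
  qed
  define u where "u = 17 * sqrt \<epsilon>"
  have "u > 0" using \<epsilon> by (simp add: u_def)
  \<comment> \<open>The logarithms of the points \<open>\<theta> k\<close> are multiples of
    \<open>u\<close>, the separation that \<open>exp_midpoint_gap\<close> asks for, and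
    \<open>N * u \<le> ln M\<close> keeps the points in \<open>[1, M]\<close>.\<close>
  define N where "N = nat \<lfloor>ln M / u\<rfloor>"
  define \<theta> where "\<theta> k = exp (real k * u)" for k
  have \<theta>: "1 \<le> \<theta> k" "\<theta> k \<le> M" if "k \<le> N" for k
  proof -
    show "1 \<le> \<theta> k" using \<open>u > 0\<close> by (simp add: \<theta>_def)
    have "0 \<le> ln M / u" using \<open>u > 0\<close> M by simp
    then have "real k \<le> ln M / u" using that unfolding N_def by linarith
    then have "real k * u \<le> ln M" using \<open>u > 0\<close> by (simp add: field_simps)
    then show "\<theta> k \<le> M" using M unfolding \<theta>_def by (simp add: ln_ge_iff)
  qed
  have mid: "\<exists>\<tau>>0. (1/2) *\<^sub>R (pt (\<theta> k) (h (\<theta> k)) + pt (\<theta> l) (h (\<theta> l))) + \<tau> *\<^sub>R e \<in> P"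
    if "k \<le> N" "l \<le> N" "k < l" for k l
  proof -
    \<comment> \<open>The height of the point supplied by \<open>low\<close> above the midpoint of
      the two topmost points. It is positive because the chord gap exceeds the error \<epsilon> of
      the averaged heights plus the error \<epsilon> at the midpoint.\<close>
    define \<tau> where "\<tau> = ln ((\<theta> k + \<theta> l) / 2) - \<epsilon> - (h (\<theta> k) + h (\<theta> l)) / 2"
    have "u * 1 \<le> u * (real l - real k)"
      using \<open>u > 0\<close> \<open>k < l\<close> by (intro mult_left_mono) auto
    then have "(real k * u + real l * u) / 2 + 2 * \<epsilon> < ln ((\<theta> k + \<theta> l) / 2)"
      unfolding \<theta>_def using \<epsilon> by (intro exp_midpoint_gap) (auto simp: u_def algebra_simps)
    moreover have "h (\<theta> k) \<le> real k * u + \<epsilon>" "h (\<theta> l) \<le> real l * u + \<epsilon>"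
      using high[OF h_mem[OF \<theta>[OF that(1)]]] high[OF h_mem[OF \<theta>[OF that(2)]]]
      by (simp_all add: \<theta>_def)
    ultimately have "\<tau> > 0" unfolding \<tau>_def by argo
    moreover have "pt ((\<theta> k + \<theta> l) / 2) (ln ((\<theta> k + \<theta> l) / 2) - \<epsilon>) \<in> P"
      using \<theta>[OF that(1)] \<theta>[OF that(2)] by (intro low) auto
    then have "(1/2) *\<^sub>R (pt (\<theta> k) (h (\<theta> k)) + pt (\<theta> l) (h (\<theta> l))) + \<tau> *\<^sub>R e \<in> P"
      by (simp add: pt_mid pt_add \<tau>_def)
    ultimately show ?thesis by blast
  qed
  have "card {..N} \<le> 2 ^ q"
  proof (rule card_topmost_points_le[OF poly, where x = "\<lambda>k. pt (\<theta> k) (h (\<theta> k))" and e = e])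
    show "pt (\<theta> k) (h (\<theta> k)) \<in> P" if "k \<in> {..N}" for k
      using that \<theta> h_mem by simp
    show "pt (\<theta> k) (h (\<theta> k)) + \<delta> *\<^sub>R e \<notin> P" if "k \<in> {..N}" "\<delta> > 0" for k \<delta>
      using that h_ge[OF \<theta>[of k], of "h (\<theta> k) + \<delta>"] by (auto simp: pt_add)
    show "\<exists>\<tau>>0. (1/2) *\<^sub>R (pt (\<theta> k) (h (\<theta> k)) + pt (\<theta> l) (h (\<theta> l))) + \<tau> *\<^sub>R e \<in> P"
      if "k \<in> {..N}" "l \<in> {..N}" "k \<noteq> l" for k l
    proof (cases "k < l")
      case True
      with that show ?thesis using mid[OF _ _ True] by simp
    next
      case False
      then have "l < k" using that by simp
      from mid[OF _ _ this] that show ?thesis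
        by (simp add: add.commute[of "pt (\<theta> k) _"])
    qed
  qed simp
  then have "real (N + 1) \<le> 2 ^ q"
    by (metis card_atMost Suc_eq_plus1 of_nat_le_iff of_nat_numeral of_nat_power)
  \<comment> \<open>Counting from 0 gives \<open>N + 1\<close> points, which makes up for rounding
    down in \<open>N\<close>.\<close>
  moreover have "ln M / u \<le> real (N + 1)" unfolding N_def by linarith
  ultimately have "ln M / u \<le> 2 ^ q" by linarith
  then show ?thesis using \<open>u > 0\<close> by (simp add: u_def field_simps)
qed

text \<open>Allows an additive constant to be absorbed into a multiple of \<open>q\<close>. With no
  inequalities \<open>P\<close> is the whole space, whereas \<open>K_exp\<close> is bounded in its
  first coordinate.\<close>

lemma polyhedral_approximation_pos:
  assumes "polyhedral_approximation q P" "P \<subseteq> K_exp M \<epsilon>"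
  shows "q > 0"
proof (rule ccontr)
  assume "\<not> q > 0"
  then have "P = UNIV" using assms(1) unfolding polyhedral_approximation_def by auto
  then have "(vector [M + 1, 0, 0] :: real^3) \<in> K_exp M \<epsilon>" using assms(2) by blast
  then show False by (simp add: K_exp_def)
qed

text \<open>The constant \<open>c\<close> depends only on \<open>M0\<close>. Keeping
  \<open>M\<close> away from 1 bounds \<open>ln (ln M)\<close> from below, and the bound is uniform
  in \<epsilon>.\<close>

theorem corollary4:
  fixes M0 :: real
  assumes "M0 > 1"
  shows "\<exists>c>0. \<forall>M\<ge>M0. \<forall>\<epsilon>\<in>{0<..1}. \<forall>q P.
           polyhedral_approximation q P \<longrightarrow> K_exp M (-\<epsilon>) \<subseteq> P \<longrightarrow> P \<subseteq> K_exp M \<epsilon> \<longrightarrow>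
           real q \<ge> c * (ln (ln M) + ln (1 / \<epsilon>))"
proof -
  define A where "A = ln 2 + ln 17 + \<bar>ln (ln M0)\<bar> / 2"
  have "ln 2 > (0::real)" "ln 17 > (0::real)" by simp_all
  then have "A > 0" unfolding A_def by linarith
  have "1 / (2 * A) * (ln (ln M) + ln (1 / \<epsilon>)) \<le> real q"
    if M: "M \<ge> M0" and \<epsilon>: "\<epsilon> \<in> {0<..1}" and poly: "polyhedral_approximation q P"
      and incl: "K_exp M (-\<epsilon>) \<subseteq> P" "P \<subseteq> K_exp M \<epsilon>" for M \<epsilon> q P
  proof -
    have "ln M0 > 0" "ln M \<ge> ln M0" using assms M by auto
    then have lnln: "ln (ln M) \<ge> ln (ln M0)" by simp
    have "ln M \<le> 17 * sqrt \<epsilon> * 2 ^ q"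
      using ln_le_two_power_polyhedral_approximation[OF poly incl] assms M \<epsilon> by auto
    then have "ln (ln M) \<le> ln (17 * sqrt \<epsilon> * 2 ^ q)"
      using \<open>ln M0 > 0\<close> \<open>ln M \<ge> ln M0\<close> by simp
    also have "\<dots> = ln 17 + ln \<epsilon> / 2 + real q * ln 2"
      using \<epsilon> by (simp add: ln_mult ln_sqrt ln_realpow)
    finally have upper: "ln (ln M) \<le> ln 17 + ln \<epsilon> / 2 + real q * ln 2" .
    have "ln (1 / \<epsilon>) = - ln \<epsilon>" using \<epsilon> by (simp add: ln_div)
    \<comment> \<open>The square root leaves only half of \<open>ln (1 / \<epsilon>)\<close>. Half
      of \<open>ln (ln M)\<close> is therefore given up as well, at a cost of at most
      \<open>\<bar>ln (ln M0)\<bar> / 2\<close> when it is negative.\<close>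
    then have "(ln (ln M) + ln (1 / \<epsilon>)) / 2 \<le> real q * ln 2 + (ln 17 + \<bar>ln (ln M0)\<bar> / 2)"
      using upper lnln by argo
    also have "\<dots> \<le> real q * ln 2 + real q * (ln 17 + \<bar>ln (ln M0)\<bar> / 2)"
    proof -
      have "1 * (ln 17 + \<bar>ln (ln M0)\<bar> / 2) \<le> real q * (ln 17 + \<bar>ln (ln M0)\<bar> / 2)"
        using polyhedral_approximation_pos[OF poly incl(2)] by (intro mult_right_mono) auto
      then show ?thesis by simp
    qed
    also have "\<dots> = real q * A" by (simp add: A_def algebra_simps)
    finally show ?thesis using \<open>A > 0\<close> by (simp add: field_simps)
  qed
  then show ?thesis using \<open>A > 0\<close> by (intro exI[of _ "1 / (2 * A)"]) auto
qed

end
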